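(* Let $(\Omega,\mathcal F,\mathbb P)$ be a standard probability space, $\theta:\Omega\to\Omega$ an invertible, bimeasurable, measure-preserving transformation, $H$ a real separable Hilbert space, and $F\subset\mathbb Z$ finite. The following are equivalent: (i) $\mathbb P\{\omega:\theta^k\omega=\theta^\ell\omega\}=0$ for all $k,\ell\in F$ with $k\ne\ell$; (ii) for every family $(A_k)_{k\in F}$ with $A_k\in\mathcal M_s^\infty(\Omega;\mathcal L(H))$, the identity $$\sum_{k\in F}M_{A_k}U^k=0\quad\text{on }L^2(\Omega;H)$$ implies $A_k=0$ almost everywhere for every $k\in F$.
   Context: $L^2(\Omega;H)$ is the Bochner space of (classes of) square-integrable $H$-valued functions. For $k\in\mathbb Z$, $U^k$ is the Koopman operator $(U^ku)(\omega)=u(\theta^k\omega)$. $\mathcal L(H)$ is the space of bounded linear operators on $H$. $\mathcal M_s^\infty(\Omega;\mathcal L(H))$ denotes the fields $A:\Omega\to\mathcal L(H)$ such that $\omega\mapsto A(\omega)v$ is strongly measurable for every $v\in H$ and $\operatorname{ess\,sup}_\omega\|A(\omega)\|<\infty$. Such $A$ defines the bounded multiplication operator $(M_Au)(\omega)=A(\omega)u(\omega)$ on $L^2(\Omega;H)$.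
   Formalization: The Hilbert space H is assumed to be nonzero; for H = {0} the equivalence fails, since (ii) holds vacuously while (i) can fail (for example θ = id, F = {0,1}). *)

theory Defs
  imports "HOL-Probability.Probability"
begin

definition standard_borel :: "'a measure \<Rightarrow> bool" where
  "standard_borel M \<longleftrightarrow>
     (\<exists>X. completely_metrizable_space X \<and> separable_space X \<and> topspace X = space M \<and>
          sets M = sigma_sets (topspace X) {U. openin X U})"

(* Two conventions for "standard probability space" are in use: a probability measure on a
   standard Borel space, or a Lebesgue-Rokhlin space, i.e. a complete probability space which is,
   up to a null set, the completion of such a space.  Both are admitted. *)
definition standard_prob_space :: "'a measure \<Rightarrow> bool" where
  "standard_prob_space M \<longleftrightarrow>
     prob_space M \<and>
     (standard_borel M \<or>
      complete_measure M \<and>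
      (\<exists>\<Omega>\<^sub>0\<in>sets M. space M - \<Omega>\<^sub>0 \<in> null_sets M \<and>
         (\<exists>N. standard_borel N \<and> restrict_space M \<Omega>\<^sub>0 = completion N)))"

definition invertible_mpt :: "'a measure \<Rightarrow> ('a \<Rightarrow> 'a) \<Rightarrow> bool" where
  "invertible_mpt M \<theta> \<longleftrightarrow>
     bij_betw \<theta> (space M) (space M) \<and>
     \<theta> \<in> measurable M M \<and>
     inv_into (space M) \<theta> \<in> measurable M M \<and>
     (\<forall>A\<in>sets M. emeasure M (\<theta> -` A \<inter> space M) = emeasure M A)"

definition int_iter :: "'a measure \<Rightarrow> ('a \<Rightarrow> 'a) \<Rightarrow> int \<Rightarrow> 'a \<Rightarrow> 'a" where
  "int_iter M \<theta> k = (if 0 \<le> k then \<theta> ^^ nat k else inv_into (space M) \<theta> ^^ nat (- k))"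

(* Elements of the Bochner space are handled through representatives, with equality meaning
   equality almost everywhere.  As H is separable, Borel measurability is strong measurability.
   The lemmas below show that both operators are well defined on classes and map the space to
   itself. *)
definition L2_space :: "'a measure \<Rightarrow> ('a \<Rightarrow> 'h::{real_inner,banach,second_countable_topology}) set" where
  "L2_space M = {u \<in> borel_measurable M. integrable M (\<lambda>\<omega>. (norm (u \<omega>))\<^sup>2)}"

definition koopman :: "'a measure \<Rightarrow> ('a \<Rightarrow> 'a) \<Rightarrow> int \<Rightarrow> ('a \<Rightarrow> 'h) \<Rightarrow> 'a \<Rightarrow> 'h" where
  "koopman M \<theta> k u = (\<lambda>\<omega>. u (int_iter M \<theta> k \<omega>))"

(* esssup is top for a non-measurable function; here the norm is automatically measurable, being
   a supremum over a countable dense set of vectors. *)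
definition Ms_infty ::
    "'a measure \<Rightarrow> ('a \<Rightarrow> 'h::{real_inner,banach,second_countable_topology} \<Rightarrow>\<^sub>L 'h) set" where
  "Ms_infty M = {A. (\<forall>v. (\<lambda>\<omega>. blinfun_apply (A \<omega>) v) \<in> borel_measurable M) \<and>
                    esssup M (\<lambda>\<omega>. ereal (norm (A \<omega>))) < \<infinity>}"

definition mult_op ::
    "('a \<Rightarrow> 'h::{real_inner,banach,second_countable_topology} \<Rightarrow>\<^sub>L 'h) \<Rightarrow> ('a \<Rightarrow> 'h) \<Rightarrow> 'a \<Rightarrow> 'h" where
  "mult_op A u = (\<lambda>\<omega>. blinfun_apply (A \<omega>) (u \<omega>))"

lemma int_iter_measurable:
  assumes "invertible_mpt M \<theta>"
  shows "int_iter M \<theta> k \<in> measurable M M"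
  using assms by (auto simp: int_iter_def invertible_mpt_def)

lemma distr_int_iter:
  assumes "invertible_mpt M \<theta>"
  shows "distr M M (int_iter M \<theta> k) = M"
proof -
  let ?j = "inv_into (space M) \<theta>"
  have t: "\<theta> \<in> measurable M M" and j: "?j \<in> measurable M M"
    and b: "bij_betw \<theta> (space M) (space M)"
    using assms by (auto simp: invertible_mpt_def)
  have dt: "distr M M \<theta> = M"
    using assms by (intro measure_eqI) (auto simp: invertible_mpt_def emeasure_distr)
  have "distr M M ?j = distr (distr M M \<theta>) M ?j"
    by (simp add: dt)
  also have "\<dots> = distr M M (?j \<circ> \<theta>)"
    by (rule distr_distr[OF j t])
  also have "\<dots> = distr M M (\<lambda>x. x)"
    using b by (intro distr_cong) (auto simp: bij_betw_def)
  finally have dj: "distr M M ?j = M"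
    by simp
  have it: "distr M M (f ^^ n) = M" if f: "f \<in> measurable M M" "distr M M f = M" for f n
  proof (induction n)
    case 0
    show ?case by (simp add: id_def)
  next
    case (Suc n)
    have "distr M M (f ^^ Suc n) = distr (distr M M (f ^^ n)) M f"
      using f(1) by (subst distr_distr) auto
    then show ?case by (simp only: Suc f(2))
  qed
  show ?thesis
    using it[OF t dt] it[OF j dj] by (simp add: int_iter_def)
qed

lemma koopman_L2:
  assumes "invertible_mpt M \<theta>" "u \<in> L2_space M"
  shows "koopman M \<theta> k u \<in> L2_space M"
proof -
  note m = int_iter_measurable[OF assms(1), of k]
  have "integrable (distr M M (int_iter M \<theta> k)) (\<lambda>\<omega>. (norm (u \<omega>))\<^sup>2)"
    using assms(2) by (simp add: distr_int_iter[OF assms(1)] L2_space_def)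
  then have "integrable M (\<lambda>\<omega>. (norm (u (int_iter M \<theta> k \<omega>)))\<^sup>2)"
    by (rule integrable_distr[OF m])
  moreover have "(\<lambda>\<omega>. u (int_iter M \<theta> k \<omega>)) \<in> borel_measurable M"
    using assms(2) by (intro measurable_compose[OF m]) (simp add: L2_space_def)
  ultimately show ?thesis by (simp add: koopman_def L2_space_def)
qed

lemma koopman_cong_AE:
  assumes "invertible_mpt M \<theta>" "AE \<omega> in M. u \<omega> = v \<omega>"
  shows "AE \<omega> in M. koopman M \<theta> k u \<omega> = koopman M \<theta> k v \<omega>"
proof -
  have "AE \<omega> in distr M M (int_iter M \<theta> k). u \<omega> = v \<omega>"
    using assms(2) unfolding distr_int_iter[OF assms(1)] .
  then show ?thesis
    unfolding koopman_def by (rule AE_distrD[OF int_iter_measurable[OF assms(1)]])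
qed

lemma mult_op_measurable:
  assumes A: "A \<in> Ms_infty M" and u: "u \<in> borel_measurable M"
  shows "mult_op A u \<in> borel_measurable M"
proof -
  obtain s where s: "\<And>i. simple_function M (s i)"
    "\<And>x. x \<in> space M \<Longrightarrow> (\<lambda>i. s i x) \<longlonglongrightarrow> u x"
    using borel_measurable_implies_sequence_metric[OF u, of 0] by blast
  show ?thesis
    unfolding mult_op_def
  proof (rule borel_measurable_LIMSEQ_metric)
    fix i
    have "(\<lambda>x. A x (s i x)) \<in> borel_measurable M \<longleftrightarrow>
        (\<lambda>x. \<Sum>v\<in>s i ` space M. indicator (s i -` {v} \<inter> space M) x *\<^sub>R A x v) \<in> borel_measurable M"
    proof (rule measurable_cong)
      fix x assume x: "x \<in> space M"
      have "(\<Sum>v\<in>s i ` space M. indicator (s i -` {v} \<inter> space M) x *\<^sub>R A x v)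
          = (\<Sum>v\<in>s i ` space M. if v = s i x then A x v else 0)"
        using x by (intro sum.cong) (auto simp: indicator_def)
      also have "\<dots> = A x (s i x)"
        using x s(1)[of i] by (simp add: simple_function_def)
      finally show "A x (s i x) =
        (\<Sum>v\<in>s i ` space M. indicator (s i -` {v} \<inter> space M) x *\<^sub>R A x v)" by simp
    qed
    moreover have "(\<lambda>x. \<Sum>v\<in>s i ` space M. indicator (s i -` {v} \<inter> space M) x *\<^sub>R A x v)
        \<in> borel_measurable M"
      using A s(1)[of i]
      by (intro borel_measurable_sum borel_measurable_scaleR borel_measurable_indicator)
         (auto simp: Ms_infty_def simple_function_def)
    ultimately show "(\<lambda>x. A x (s i x)) \<in> borel_measurable M" by simp
  next
    fix x assume "x \<in> space M"
    then show "(\<lambda>i. A x (s i x)) \<longlonglongrightarrow> A x (u x)"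
      by (intro tendsto_intros s(2))
  qed
qed

lemma mult_op_L2:
  assumes A: "A \<in> Ms_infty M" and u: "u \<in> L2_space M"
  shows "mult_op A u \<in> L2_space M"
proof -
  let ?e = "esssup M (\<lambda>\<omega>. ereal (norm (A \<omega>)))"
  have meas: "mult_op A u \<in> borel_measurable M"
    using mult_op_measurable[OF A] u by (simp add: L2_space_def)
  obtain c :: real where c: "?e \<le> ereal c"
  proof (cases ?e)
    case PInf
    then show ?thesis using A by (simp add: Ms_infty_def)
  next
    case MInf
    then show ?thesis using that[of 0] by simp
  next
    case (real r)
    then show ?thesis using that[of r] by simp
  qed
  have bound: "AE \<omega> in M. norm ((norm (mult_op A u \<omega>))\<^sup>2) \<le> norm (c\<^sup>2 * (norm (u \<omega>))\<^sup>2)"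
    using esssup_AE[of "\<lambda>\<omega>. ereal (norm (A \<omega>))" M]
  proof (rule AE_mp, intro AE_I2 impI)
    fix \<omega> assume "ereal (norm (A \<omega>)) \<le> ?e"
    then have "norm (A \<omega>) \<le> c"
      using c ereal_less_eq(3) order_trans by blast
    then have "norm (A \<omega> (u \<omega>)) \<le> c * norm (u \<omega>)"
      by (meson norm_blinfun order_trans mult_right_mono norm_ge_zero)
    then have "(norm (A \<omega> (u \<omega>)))\<^sup>2 \<le> (c * norm (u \<omega>))\<^sup>2"
      by (intro power_mono) auto
    then show "norm ((norm (mult_op A u \<omega>))\<^sup>2) \<le> norm (c\<^sup>2 * (norm (u \<omega>))\<^sup>2)"
      by (simp add: mult_op_def power_mult_distrib abs_mult)
  qed
  have "integrable M (\<lambda>\<omega>. c\<^sup>2 * (norm (u \<omega>))\<^sup>2)"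
    using u by (intro integrable_mult_right) (simp add: L2_space_def)
  moreover have "(\<lambda>\<omega>. (norm (mult_op A u \<omega>))\<^sup>2) \<in> borel_measurable M"
    using meas by measurable
  ultimately have "integrable M (\<lambda>\<omega>. (norm (mult_op A u \<omega>))\<^sup>2)"
    using bound by (rule Bochner_Integration.integrable_bound)
  with meas show ?thesis by (simp add: L2_space_def)
qed

lemma mult_op_cong_AE:
  assumes "AE \<omega> in M. u \<omega> = v \<omega>"
  shows "AE \<omega> in M. mult_op A u \<omega> = mult_op A v \<omega>"
  using assms by (auto simp: mult_op_def elim: eventually_mono)

end

theory Submission
  imports Defs
begin

text \<open>
  Why the theorem holds. A standard probability space carries a countable family of measurable
  sets that, on a conull set, isolates a point from any finite set of other points
  (\<open>countable_isolating_family\<close>).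

  If the points \<open>\<theta>\<^sup>k \<omega>\<close>, \<open>k \<in> F\<close>, are almost surely distinct, test the operator identity on
  \<open>u = indicator B *\<^sub>R v\<close> with \<open>B\<close> in this family and \<open>v\<close> in a countable dense subset of \<open>H\<close>.
  These are countably many functions, so one conull set of \<open>\<omega>\<close> serves all of them. At such an
  \<open>\<omega>\<close> a set \<open>B\<close> that contains \<open>\<theta>\<^sup>k \<omega>\<close> but no other \<open>\<theta>\<^sup>l \<omega>\<close> reduces the sum to the single term
  \<open>A\<^sub>k(\<omega>) v\<close>, which therefore vanishes for all \<open>v\<close> in a dense set.

  Conversely, let \<open>E\<close> be the set where \<open>\<theta>\<^sup>k\<close> and \<open>\<theta>\<^sup>l\<close> agree, for \<open>k \<noteq> l\<close> in \<open>F\<close>. It is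
  measurable, again because countably many measurable sets separate points (\<open>coincidence_set_measurable\<close>). The fields \<open>A\<^sub>k = 1\<^sub>E id\<close>,
  \<open>A\<^sub>l = - 1\<^sub>E id\<close>, and zero elsewhere, satisfy the operator identity, because
  \<open>1\<^sub>E(\<omega>) (u(\<theta>\<^sup>k \<omega>) - u(\<theta>\<^sup>l \<omega>)) = 0\<close>. So \<open>A\<^sub>k = 0\<close> almost everywhere, and since \<open>H\<close> is nontrivial
  this says that \<open>E\<close> is null.
\<close>

section \<open>Countable families that isolate points\<close>

text \<open>
  Balls of rational radius around a countable dense set suffice: a ball whose centre lies within
  half the distance of \<open>x\<close> and \<open>y\<close> from \<open>x\<close> can be given a radius that leaves \<open>y\<close> outside.
\<close>

lemma standard_borel_countable_separating:
  assumes "standard_borel N"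
  obtains \<B> where "countable \<B>" "\<B> \<subseteq> sets N"
    "\<forall>x\<in>space N. \<forall>y\<in>space N. x \<noteq> y \<longrightarrow> (\<exists>B\<in>\<B>. x \<in> B \<and> y \<notin> B)"
proof -
  obtain X where X: "completely_metrizable_space X" "separable_space X" "topspace X = space N"
    "sets N = sigma_sets (topspace X) {U. openin X U}"
    using assms by (auto simp: standard_borel_def)
  obtain S d where "Metric_space S d" and Xd: "X = Metric_space.mtopology S d"
    using completely_metrizable_imp_metrizable_space[OF X(1)] by (auto simp: metrizable_space_def)
  then interpret Metric_space S d by simp
  have S: "S = space N" using X(3) Xd by simp
  obtain C where C: "countable C" "C \<subseteq> S" "mtopology closure_of C = S"
    using X(2) Xd by (auto simp: separable_space_def)
  define \<B> where "\<B> = (\<lambda>(c, q). mball c (real_of_rat q)) ` (C \<times> UNIV)"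
  show thesis
  proof (rule that)
    show "countable \<B>" using C(1) by (auto simp: \<B>_def)
    show "\<B> \<subseteq> sets N"
      unfolding X(4) Xd by (auto simp: \<B>_def intro!: sigma_sets.Basic)
    show "\<forall>x\<in>space N. \<forall>y\<in>space N. x \<noteq> y \<longrightarrow> (\<exists>B\<in>\<B>. x \<in> B \<and> y \<notin> B)"
    proof (intro ballI impI)
      fix x y assume xy: "x \<in> space N" "y \<in> space N" "x \<noteq> y"
      then have pos: "0 < d x y" using S by simp
      have "x \<in> mtopology closure_of C" using C(3) xy(1) S by simp
      then have "\<forall>r>0. \<exists>c\<in>C. c \<in> mball x r"
        unfolding metric_closure_of by blast
      then have "\<exists>c\<in>C. c \<in> mball x (d x y / 2)"
        using pos half_gt_zero by blast
      then obtain c where c: "c \<in> C" "c \<in> S" "d x c < d x y / 2" by auto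
      obtain q where q: "d x c < real_of_rat q" "real_of_rat q < d x y / 2"
        using of_rat_dense[OF c(3)] by blast
      have "d x y \<le> d x c + d c y"
        using triangle xy c(2) S by blast
      moreover have "x \<in> S" "y \<in> S" using xy S by auto
      ultimately have "x \<in> mball c (real_of_rat q)" "y \<notin> mball c (real_of_rat q)"
        using q c(2,3) commute[of c x] unfolding in_mball by linarith+
      then show "\<exists>B\<in>\<B>. x \<in> B \<and> y \<notin> B"
        using c(1) by (force simp: \<B>_def)
    qed
  qed
qed

text \<open>
  The two conventions for standardness are brought to a common form. The last property serves to
  discard the exceptional set: either it is empty, or all subsets of null sets are measurable.
\<close>

lemma standard_prob_space_countable_separating:
  assumes "standard_prob_space M"
  obtains \<Omega>\<^sub>0 \<B> where "\<Omega>\<^sub>0 \<in> sets M" "countable \<B>" "\<B> \<subseteq> sets M"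
    "\<forall>x\<in>\<Omega>\<^sub>0. \<forall>y\<in>\<Omega>\<^sub>0. x \<noteq> y \<longrightarrow> (\<exists>B\<in>\<B>. x \<in> B \<and> y \<notin> B)"
    "space M - \<Omega>\<^sub>0 \<in> null_sets M"
    "\<Omega>\<^sub>0 = space M \<or> complete_measure M"
proof -
  consider "standard_borel M" |
    \<Omega>\<^sub>0 N where "complete_measure M" "\<Omega>\<^sub>0 \<in> sets M" "space M - \<Omega>\<^sub>0 \<in> null_sets M"
      "standard_borel N" "restrict_space M \<Omega>\<^sub>0 = completion N"
    using assms by (auto simp: standard_prob_space_def)
  then show thesis
  proof cases
    case 1
    obtain \<B> where \<B>: "countable \<B>" "\<B> \<subseteq> sets M"
      "\<forall>x\<in>space M. \<forall>y\<in>space M. x \<noteq> y \<longrightarrow> (\<exists>B\<in>\<B>. x \<in> B \<and> y \<notin> B)"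
      using standard_borel_countable_separating[OF 1] by blast
    show thesis
      by (rule that[of "space M" \<B>]) (use \<B> in simp_all)
  next
    case (2 \<Omega>\<^sub>0 N)
    obtain \<B> where \<B>: "countable \<B>" "\<B> \<subseteq> sets N"
      "\<forall>x\<in>space N. \<forall>y\<in>space N. x \<noteq> y \<longrightarrow> (\<exists>B\<in>\<B>. x \<in> B \<and> y \<notin> B)"
      using standard_borel_countable_separating[OF 2(4)] by blast
    have "space (restrict_space M \<Omega>\<^sub>0) = space N"
      by (simp add: 2(5))
    then have sp: "space N = \<Omega>\<^sub>0"
      using sets.sets_into_space[OF 2(2)] by (auto simp: space_restrict_space)
    have "sets N \<subseteq> sets (restrict_space M \<Omega>\<^sub>0)"
      by (auto simp: 2(5))
    then have "sets N \<subseteq> sets M"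
      using 2(2) by (auto simp: sets_restrict_space)
    then have "\<B> \<subseteq> sets M" using \<B>(2) by blast
    moreover note \<B>(3)[unfolded sp]
    ultimately show thesis using \<B>(1) 2(1-3) by (intro that[of \<Omega>\<^sub>0 \<B>]) blast+
  qed
qed

text \<open>
  Finite intersections of separating sets remain countably many, and one of them isolates a point
  from finitely many others.
\<close>

lemma countable_isolating_family:
  assumes "standard_prob_space M"
  obtains \<Omega>\<^sub>0 \<B> where "countable \<B>" "\<B> \<subseteq> sets M"
    "\<forall>x\<in>\<Omega>\<^sub>0. \<forall>S. finite S \<longrightarrow> S \<subseteq> \<Omega>\<^sub>0 - {x} \<longrightarrow> (\<exists>B\<in>\<B>. x \<in> B \<and> B \<inter> S = {})"
    "space M - \<Omega>\<^sub>0 \<in> null_sets M"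
proof -
  obtain \<Omega>\<^sub>0 \<B> where \<Omega>: "\<Omega>\<^sub>0 \<in> sets M"
    and \<B>: "countable \<B>" "\<B> \<subseteq> sets M"
      "\<forall>x\<in>\<Omega>\<^sub>0. \<forall>y\<in>\<Omega>\<^sub>0. x \<noteq> y \<longrightarrow> (\<exists>B\<in>\<B>. x \<in> B \<and> y \<notin> B)"
    and conull: "space M - \<Omega>\<^sub>0 \<in> null_sets M"
    by (rule standard_prob_space_countable_separating[OF assms])
  define \<C> where "\<C> = (\<lambda>T. space M \<inter> \<Inter>T) ` {T. finite T \<and> T \<subseteq> \<B>}"
  show thesis
  proof (rule that[OF _ _ _ conull])
    show "countable \<C>"
      unfolding \<C>_def using countable_Collect_finite_subset[OF \<B>(1)] by simp
    have "space M \<inter> \<Inter>T \<in> sets M" if "finite T" "T \<subseteq> \<B>" for T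
      using that
    proof (induction T rule: finite_induct)
      case (insert B T)
      then have "B \<inter> (space M \<inter> \<Inter>T) \<in> sets M" using \<B>(2) by auto
      then show ?case by (simp add: Int_left_commute)
    qed simp
    then show "\<C> \<subseteq> sets M" by (auto simp: \<C>_def)
    show "\<forall>x\<in>\<Omega>\<^sub>0. \<forall>S. finite S \<longrightarrow> S \<subseteq> \<Omega>\<^sub>0 - {x} \<longrightarrow> (\<exists>B\<in>\<C>. x \<in> B \<and> B \<inter> S = {})"
    proof (intro ballI allI impI)
      fix x S assume x: "x \<in> \<Omega>\<^sub>0" and S: "finite S" "S \<subseteq> \<Omega>\<^sub>0 - {x}"
      have "\<exists>B. B \<in> \<B> \<and> x \<in> B \<and> y \<notin> B" if "y \<in> S" for y
        using \<B>(3)[rule_format, of x y] x S(2) that by auto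
      then obtain f where f: "f y \<in> \<B>" "x \<in> f y" "y \<notin> f y" if "y \<in> S" for y
        by metis
      let ?B = "space M \<inter> \<Inter>(f ` S)"
      show "\<exists>B\<in>\<C>. x \<in> B \<and> B \<inter> S = {}"
      proof (intro bexI conjI)
        show "x \<in> ?B" using x f(2) sets.sets_into_space[OF \<Omega>] by auto
        show "?B \<inter> S = {}" using f(3) by auto
        have "f ` S \<subseteq> \<B>" using f(1) by auto
        then show "?B \<in> \<C>" unfolding \<C>_def using S(1) by blast
      qed
    qed
  qed
qed

text \<open>
  Inside the good set, two values differ exactly if some set of the countable family contains the
  first and not the second. As both maps preserve the measure, they take values outside the good
  set only on a null set, where completeness provides measurability.
\<close>

lemma coincidence_set_measurable:
  assumes M: "standard_prob_space M"
    and f: "f \<in> measurable M M" "distr M M f = M"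
    and g: "g \<in> measurable M M" "distr M M g = M"
  shows "{\<omega> \<in> space M. f \<omega> = g \<omega>} \<in> sets M"
proof -
  obtain \<Omega>\<^sub>0 \<B> where \<Omega>: "\<Omega>\<^sub>0 \<in> sets M"
    and \<B>: "countable \<B>" "\<B> \<subseteq> sets M"
      "\<forall>x\<in>\<Omega>\<^sub>0. \<forall>y\<in>\<Omega>\<^sub>0. x \<noteq> y \<longrightarrow> (\<exists>B\<in>\<B>. x \<in> B \<and> y \<notin> B)"
    and conull: "space M - \<Omega>\<^sub>0 \<in> null_sets M"
    and all_or_complete: "\<Omega>\<^sub>0 = space M \<or> complete_measure M"
    by (rule standard_prob_space_countable_separating[OF M])
  let ?E = "{\<omega> \<in> space M. f \<omega> = g \<omega>}"
  let ?G = "(f -` \<Omega>\<^sub>0 \<inter> space M) \<inter> (g -` \<Omega>\<^sub>0 \<inter> space M)"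
  let ?D = "\<Union>B\<in>\<B>. (f -` B \<inter> space M) - (g -` B \<inter> space M)"
  have eq: "?E \<inter> ?G = ?G - ?D"
  proof (intro equalityI subsetI)
    fix \<omega> assume \<omega>: "\<omega> \<in> ?G - ?D"
    then have "f \<omega> = g \<omega>" using \<B>(3) by blast
    with \<omega> show "\<omega> \<in> ?E \<inter> ?G" by blast
  qed auto
  have "?G - ?D \<in> sets M"
  proof (rule sets.Diff)
    show "?G \<in> sets M"
      using measurable_sets[OF f(1) \<Omega>] measurable_sets[OF g(1) \<Omega>] by (rule sets.Int)
    show "?D \<in> sets M"
    proof (rule sets.countable_UN''[OF \<B>(1)])
      fix B assume "B \<in> \<B>"
      then have "B \<in> sets M" using \<B>(2) by blast
      then show "(f -` B \<inter> space M) - (g -` B \<inter> space M) \<in> sets M"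
        by (intro sets.Diff measurable_sets[OF f(1)] measurable_sets[OF g(1)])
    qed
  qed
  then have in_G: "?E \<inter> ?G \<in> sets M" unfolding eq .
  have out_G: "?E - ?G \<in> sets M"
    using all_or_complete
  proof
    assume "\<Omega>\<^sub>0 = space M"
    then have "?E - ?G = {}"
      using f(1) g(1) by (auto dest: measurable_space)
    then show ?thesis by (metis sets.empty_sets)
  next
    assume c: "complete_measure M"
    have null: "h -` (space M - \<Omega>\<^sub>0) \<inter> space M \<in> null_sets M"
      if h: "h \<in> measurable M M" "distr M M h = M" for h
      using conull h null_sets_distr_iff[OF h(1), of "space M - \<Omega>\<^sub>0"] by auto
    have "?E - ?G \<subseteq> (f -` (space M - \<Omega>\<^sub>0) \<inter> space M) \<union> (g -` (space M - \<Omega>\<^sub>0) \<inter> space M)"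
      using f(1) g(1) by (auto dest: measurable_space)
    then show ?thesis
      using complete_measure.complete[OF c] null_sets.Un[OF null[OF f] null[OF g]] by blast
  qed
  show ?thesis using sets.Un[OF in_G out_G] unfolding Int_Diff_Un .
qed

section \<open>Test functions and test fields\<close>

lemma indicator_scaleR_L2:
  fixes v :: "'h::{real_inner,banach,second_countable_topology}"
  assumes "finite_measure M" "B \<in> sets M"
  shows "(\<lambda>\<omega>. indicator B \<omega> *\<^sub>R v) \<in> L2_space M"
proof -
  interpret finite_measure M by fact
  have "(\<lambda>\<omega>. (norm (indicator B \<omega> *\<^sub>R v))\<^sup>2) = (\<lambda>\<omega>. indicator B \<omega> * (norm v)\<^sup>2)"
    by (auto simp: indicator_def)
  moreover have "integrable M (\<lambda>\<omega>. indicator B \<omega> * (norm v)\<^sup>2 :: real)"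
    using assms by (intro integrable_mult_left integrable_real_indicator) (auto simp: emeasure_eq_measure)
  ultimately show ?thesis
    using assms by (auto simp: L2_space_def intro!: borel_measurable_scaleR)
qed

lemma indicator_id_Ms_infty:
  assumes E: "E \<in> sets M"
  shows "(\<lambda>\<omega>. (c * indicator E \<omega>) *\<^sub>R
    (id_blinfun :: 'h::{real_inner,banach,second_countable_topology} \<Rightarrow>\<^sub>L 'h)) \<in> Ms_infty M"
    (is "?A \<in> _")
proof -
  have "esssup M (\<lambda>\<omega>. ereal (norm (?A \<omega>))) \<le> ereal (\<bar>c\<bar> * norm (id_blinfun :: 'h \<Rightarrow>\<^sub>L 'h))"
  proof (rule esssup_I)
    show "(\<lambda>\<omega>. ereal (norm (?A \<omega>))) \<in> borel_measurable M"
      using E by (simp add: borel_measurable_times)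
    show "AE \<omega> in M. ereal (norm (?A \<omega>)) \<le> ereal (\<bar>c\<bar> * norm (id_blinfun :: 'h \<Rightarrow>\<^sub>L 'h))"
      by (intro AE_I2) (auto simp: indicator_def)
  qed
  then have "esssup M (\<lambda>\<omega>. ereal (norm (?A \<omega>))) < \<infinity>"
    using le_less_trans by fastforce
  then show ?thesis
    using E by (auto simp: Ms_infty_def scaleR_blinfun.rep_eq intro!: borel_measurable_scaleR borel_measurable_times)
qed

section \<open>Independence of the Koopman powers\<close>

text \<open>
  An indicator function that isolates one orbit point singles out one coefficient. Countability of
  the test functions is what allows the set \<open>B\<close> to be chosen depending on \<open>\<omega>\<close>.
\<close>

lemma distinct_orbit_imp_independent:
  fixes A :: "int \<Rightarrow> 'a \<Rightarrow> 'h::{real_inner,banach,second_countable_topology} \<Rightarrow>\<^sub>L 'h"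
  assumes M: "standard_prob_space M" and \<theta>: "invertible_mpt M \<theta>" and F: "finite F"
    and distinct: "\<And>k l. k \<in> F \<Longrightarrow> l \<in> F \<Longrightarrow> k \<noteq> l \<Longrightarrow>
      {\<omega> \<in> space M. int_iter M \<theta> k \<omega> = int_iter M \<theta> l \<omega>} \<in> null_sets M"
    and zero: "\<And>u. u \<in> L2_space M \<Longrightarrow>
      AE \<omega> in M. (\<Sum>k\<in>F. mult_op (A k) (koopman M \<theta> k u) \<omega>) = 0"
    and k: "k \<in> F"
  shows "AE \<omega> in M. A k \<omega> = 0"
proof -
  have fin: "finite_measure M"
    using M by (simp add: standard_prob_space_def prob_space_def)
  obtain \<Omega>\<^sub>0 \<B> where \<B>: "countable \<B>" "\<B> \<subseteq> sets M"
      "\<forall>x\<in>\<Omega>\<^sub>0. \<forall>S. finite S \<longrightarrow> S \<subseteq> \<Omega>\<^sub>0 - {x} \<longrightarrow> (\<exists>B\<in>\<B>. x \<in> B \<and> B \<inter> S = {})"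
    and \<Omega>: "space M - \<Omega>\<^sub>0 \<in> null_sets M"
    by (rule countable_isolating_family[OF M])
  obtain D :: "'h set" where D: "countable D" "\<And>U. open U \<Longrightarrow> U \<noteq> {} \<Longrightarrow> \<exists>v\<in>D. v \<in> U"
    using countable_dense_setE by blast
  have F': "countable F" using F by (rule countable_finite)
  have good: "AE \<omega> in M. \<forall>l\<in>F. int_iter M \<theta> l \<omega> \<in> \<Omega>\<^sub>0"
    unfolding AE_ball_countable[OF F']
  proof
    fix l
    have "AE \<omega> in M. \<omega> \<in> \<Omega>\<^sub>0"
      by (rule AE_I'[OF \<Omega>]) auto
    then have "AE \<omega> in distr M M (int_iter M \<theta> l). \<omega> \<in> \<Omega>\<^sub>0"
      unfolding distr_int_iter[OF \<theta>] .
    then show "AE \<omega> in M. int_iter M \<theta> l \<omega> \<in> \<Omega>\<^sub>0"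
      by (rule AE_distrD[OF int_iter_measurable[OF \<theta>]])
  qed
  have dist: "AE \<omega> in M. \<forall>l\<in>F. l \<noteq> k \<longrightarrow> int_iter M \<theta> k \<omega> \<noteq> int_iter M \<theta> l \<omega>"
    unfolding AE_ball_countable[OF F']
  proof
    fix l assume "l \<in> F"
    show "AE \<omega> in M. l \<noteq> k \<longrightarrow> int_iter M \<theta> k \<omega> \<noteq> int_iter M \<theta> l \<omega>"
    proof (cases "l = k")
      case False
      with distinct[OF k \<open>l \<in> F\<close>] show ?thesis
        by (intro AE_I'[of "{\<omega> \<in> space M. int_iter M \<theta> k \<omega> = int_iter M \<theta> l \<omega>}"]) auto
    qed simp
  qed
  have tests: "AE \<omega> in M. \<forall>B\<in>\<B>. \<forall>v\<in>D.
      (\<Sum>l\<in>F. indicator B (int_iter M \<theta> l \<omega>) *\<^sub>R A l \<omega> v) = 0"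
    unfolding AE_ball_countable[OF \<B>(1)] AE_ball_countable[OF D(1)]
  proof (intro ballI)
    fix B v assume "B \<in> \<B>" "v \<in> D"
    then have "(\<lambda>\<omega>. indicator B \<omega> *\<^sub>R v) \<in> L2_space M"
      using \<B>(2) by (intro indicator_scaleR_L2[OF fin]) auto
    from zero[OF this]
    show "AE \<omega> in M. (\<Sum>l\<in>F. indicator B (int_iter M \<theta> l \<omega>) *\<^sub>R A l \<omega> v) = 0"
      by (simp add: mult_op_def koopman_def blinfun.scaleR_right)
  qed
  show ?thesis
    using good dist tests
  proof eventually_elim
    fix \<omega>
    assume good: "\<forall>l\<in>F. int_iter M \<theta> l \<omega> \<in> \<Omega>\<^sub>0"
      and dist: "\<forall>l\<in>F. l \<noteq> k \<longrightarrow> int_iter M \<theta> k \<omega> \<noteq> int_iter M \<theta> l \<omega>"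
      and tests: "\<forall>B\<in>\<B>. \<forall>v\<in>D. (\<Sum>l\<in>F. indicator B (int_iter M \<theta> l \<omega>) *\<^sub>R A l \<omega> v) = 0"
    let ?S = "(\<lambda>l. int_iter M \<theta> l \<omega>) ` (F - {k})"
    have "\<exists>B\<in>\<B>. int_iter M \<theta> k \<omega> \<in> B \<and> B \<inter> ?S = {}"
      using good dist k F by (intro \<B>(3)[rule_format]) auto
    then obtain B where B: "B \<in> \<B>" "int_iter M \<theta> k \<omega> \<in> B" "B \<inter> ?S = {}"
      by blast
    have on_D: "A k \<omega> v = 0" if "v \<in> D" for v
    proof -
      have "(\<Sum>l\<in>F. indicator B (int_iter M \<theta> l \<omega>) *\<^sub>R A l \<omega> v) = (\<Sum>l\<in>F. if l = k then A l \<omega> v else 0)"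
        using B(2,3) by (intro sum.cong) (auto simp: indicator_def)
      then show ?thesis using tests B(1) that F k by simp
    qed
    show "A k \<omega> = 0"
    proof (rule blinfun_eqI)
      fix w
      have "open {x. A k \<omega> x \<noteq> 0}"
        by (intro open_Collect_neq continuous_intros)
      then have "{x. A k \<omega> x \<noteq> 0} = {}"
        using D(2) on_D by blast
      then show "A k \<omega> w = blinfun_apply 0 w" by auto
    qed
  qed
qed

text \<open>
  Restricted to the set \<open>E\<close> where they coincide, the two powers give the relation
  \<open>1\<^sub>E (U\<^sup>k - U\<^sup>l) = 0\<close>; independence forces its coefficient \<open>1\<^sub>E id\<close> to vanish.
\<close>

lemma independent_imp_distinct_orbit:
  assumes M: "standard_prob_space M" and \<theta>: "invertible_mpt M \<theta>" and F: "finite F"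
    and nontrivial: "\<exists>v::'h::{real_inner,banach,second_countable_topology}. v \<noteq> 0"
    and indep: "\<And>A :: int \<Rightarrow> 'a \<Rightarrow> 'h \<Rightarrow>\<^sub>L 'h. (\<And>k. k \<in> F \<Longrightarrow> A k \<in> Ms_infty M) \<Longrightarrow>
      (\<And>u. u \<in> L2_space M \<Longrightarrow>
        AE \<omega> in M. (\<Sum>k\<in>F. mult_op (A k) (koopman M \<theta> k u) \<omega>) = 0) \<Longrightarrow>
      (\<And>k. k \<in> F \<Longrightarrow> AE \<omega> in M. A k \<omega> = 0)"
    and kl: "k \<in> F" "l \<in> F" "k \<noteq> l"
  shows "{\<omega> \<in> space M. int_iter M \<theta> k \<omega> = int_iter M \<theta> l \<omega>} \<in> null_sets M"
proof -
  define E where "E = {\<omega> \<in> space M. int_iter M \<theta> k \<omega> = int_iter M \<theta> l \<omega>}"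
  have E: "E \<in> sets M"
    unfolding E_def
    by (intro coincidence_set_measurable[OF M] int_iter_measurable[OF \<theta>] distr_int_iter[OF \<theta>])
  define c :: "int \<Rightarrow> real" where "c j = (if j = k then 1 else 0) - (if j = l then 1 else 0)" for j
  define A :: "int \<Rightarrow> 'a \<Rightarrow> 'h \<Rightarrow>\<^sub>L 'h"
    where "A j = (\<lambda>\<omega>. (c j * indicator E \<omega>) *\<^sub>R id_blinfun)" for j
  have "AE \<omega> in M. A k \<omega> = 0"
  proof (rule indep)
    show "A j \<in> Ms_infty M" for j
      unfolding A_def by (rule indicator_id_Ms_infty[OF E])
    show "AE \<omega> in M. (\<Sum>j\<in>F. mult_op (A j) (koopman M \<theta> j u) \<omega>) = 0" for u
    proof (intro AE_I2)
      fix \<omega>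
      have "(\<Sum>j\<in>F. mult_op (A j) (koopman M \<theta> j u) \<omega>)
          = indicator E \<omega> *\<^sub>R (\<Sum>j\<in>F. c j *\<^sub>R u (int_iter M \<theta> j \<omega>))"
        by (simp add: mult_op_def koopman_def A_def scaleR_blinfun.rep_eq scaleR_sum_right mult.commute)
      also have "(\<Sum>j\<in>F. c j *\<^sub>R u (int_iter M \<theta> j \<omega>))
          = (\<Sum>j\<in>F. if j = k then u (int_iter M \<theta> j \<omega>) else 0)
          - (\<Sum>j\<in>F. if j = l then u (int_iter M \<theta> j \<omega>) else 0)"
        unfolding sum_subtractf[symmetric] by (intro sum.cong) (auto simp: c_def)
      also have "\<dots> = u (int_iter M \<theta> k \<omega>) - u (int_iter M \<theta> l \<omega>)"
        using F kl by simp
      also have "indicator E \<omega> *\<^sub>R (u (int_iter M \<theta> k \<omega>) - u (int_iter M \<theta> l \<omega>)) = 0"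
        by (auto simp: E_def indicator_def)
      finally show "(\<Sum>j\<in>F. mult_op (A j) (koopman M \<theta> j u) \<omega>) = 0" .
    qed
  qed (rule kl(1))
  moreover have "A k \<omega> \<noteq> 0" if "\<omega> \<in> E" for \<omega>
  proof
    assume "A k \<omega> = 0"
    then have "A k \<omega> v = 0" for v by simp
    then show False
      using that kl(3) nontrivial by (simp add: A_def c_def scaleR_blinfun.rep_eq)
  qed
  ultimately have "AE \<omega> in M. \<omega> \<notin> E"
    by (auto elim: eventually_mono)
  then show ?thesis
    using E AE_iff_null_sets[OF E] by (simp add: E_def)
qed

theorem theorem4p2:
  fixes M :: "'a measure" and \<theta> :: "'a \<Rightarrow> 'a" and F :: "int set"
  assumes "standard_prob_space M"
    and "invertible_mpt M \<theta>"
    and "finite F"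
    and "\<exists>v::'h::{real_inner,banach,second_countable_topology}. v \<noteq> 0"
  shows "(\<forall>k\<in>F. \<forall>l\<in>F. k \<noteq> l \<longrightarrow>
            {\<omega> \<in> space M. int_iter M \<theta> k \<omega> = int_iter M \<theta> l \<omega>} \<in> null_sets M)
    \<longleftrightarrow>
    (\<forall>A :: int \<Rightarrow> 'a \<Rightarrow> 'h \<Rightarrow>\<^sub>L 'h.
        (\<forall>k\<in>F. A k \<in> Ms_infty M) \<longrightarrow>
        (\<forall>u\<in>L2_space M. AE \<omega> in M. (\<Sum>k\<in>F. mult_op (A k) (koopman M \<theta> k u) \<omega>) = 0) \<longrightarrow>
        (\<forall>k\<in>F. AE \<omega> in M. A k \<omega> = 0))"
    (is "?distinct \<longleftrightarrow> ?independent")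
proof
  assume ?distinct
  then show ?independent
    by (intro allI impI ballI distinct_orbit_imp_independent[OF assms(1-3)]) auto
next
  assume ?independent
  then show ?distinct
    by (intro ballI impI independent_imp_distinct_orbit[OF assms]) auto
qed

end
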